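(* Let $m\ge 2$ and let $(a_1,\dots,a_n)$ be any ordering of the set $\{s_{i,j}\mid 1\le i<j\le m\}$ that is a Mal'cev basis of $UT_m(\mathbb Z)$. Then the dimension of Nickel's embedding of $UT_m(\mathbb Z)$ with respect to $(a_1,\dots,a_n)$ (the embedding produced by Nickel's algorithm) is at most $3^m$.
   Context: $UT_m(\mathbb Z)$ is the group of upper triangular $m\times m$ integer matrices with all diagonal entries equal to $1$. For $1\le i<j\le m$, $s_{i,j}=1+e_{i,j}$, where $e_{i,j}$ is the matrix with $(i,j)$ entry $1$ and all other entries $0$. A Mal'cev basis of a finitely generated torsion-free nilpotent group $G$ is a tuple $(a_1,\dots,a_n)$ of elements of $G$ such that every $g\in G$ can be written uniquely as $g=a_1^{x_1}\cdots a_n^{x_n}$ with $x_i\in\mathbb Z$, and such that $G=G_1>G_2>\cdots>G_n>1$ with $G_i=\langle a_i,\dots,a_n\rangle$ is a central series. Nickel's embedding with respect to a Mal'cev basis $(a_1,\dots,a_n)$: $G$ acts on $(\mathbb QG)^*$ (the space of $\mathbb{Q}$-linear maps $\mathbb QG\to\mathbb Q$, identified with functions $G\to\mathbb Q$) by $f^g(h)=f(hg^{-1})$. The coordinate functions are $t_i:G\to\mathbb Z$, $t_i(a_1^{x_1}\cdots a_n^{x_n})=x_i$. The $G$-submodule of $(\mathbb QG)^*$ generated by $t_1,\dots,t_n$ is a finite-dimensional faithful $G$-module, and Nickel's embedding is the resulting unitriangular matrix representation of $G$. Its dimension is the dimension over $\mathbb Q$ of this $G$-submodule. *)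

theory Defs
  imports
    "Jordan_Normal_Form.Matrix"
    "HOL-Algebra.Generated_Groups"
    "HOL-Library.Function_Algebras"
begin

definition UT :: "nat \<Rightarrow> int mat monoid" where
  "UT m = \<lparr>carrier = {A \<in> carrier_mat m m. upper_triangular A \<and> (\<forall>i<m. A $$ (i,i) = 1)},
           monoid.mult = (*), one = 1\<^sub>m m\<rparr>"

text \<open>Matrix indices in \<^theory>\<open>Jordan_Normal_Form.Matrix\<close> start at 0, so the pairs
  \<open>1 \<le> i < j \<le> m\<close> of the usual notation become \<open>i < j < m\<close>.\<close>

definition elem_mat :: "nat \<Rightarrow> nat \<Rightarrow> nat \<Rightarrow> int mat" where
  "elem_mat m i j = mat m m (\<lambda>(k,l). if k = i \<and> l = j then 1 else 0)"

definition transvection :: "nat \<Rightarrow> nat \<Rightarrow> nat \<Rightarrow> int mat" where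
  "transvection m i j = 1\<^sub>m m + elem_mat m i j"

text \<open>Only used for lists of equal length, since \<^const>\<open>zip\<close> truncates.\<close>

definition malcev_prod :: "('a, 'b) monoid_scheme \<Rightarrow> 'a list \<Rightarrow> int list \<Rightarrow> 'a" where
  "malcev_prod G as xs =
     foldr (\<lambda>(a, x) g. (a [^]\<^bsub>G\<^esub> x) \<otimes>\<^bsub>G\<^esub> g) (zip as xs) \<one>\<^bsub>G\<^esub>"

text \<open>With 0-based \<open>i\<close>, \<open>malcev_series G as i\<close> is the subgroup usually written \<open>G_(i+1)\<close>;
  for \<open>i = length as\<close> it is trivial.\<close>

definition malcev_series :: "('a, 'b) monoid_scheme \<Rightarrow> 'a list \<Rightarrow> nat \<Rightarrow> 'a set" where
  "malcev_series G as i = generate G (set (drop i as))"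

definition malcev_basis :: "('a, 'b) monoid_scheme \<Rightarrow> 'a list \<Rightarrow> bool" where
  "malcev_basis G as \<longleftrightarrow>
     set as \<subseteq> carrier G \<and>
     (\<forall>g \<in> carrier G. \<exists>!xs. length xs = length as \<and> g = malcev_prod G as xs) \<and>
     malcev_series G as 0 = carrier G \<and>
     (\<forall>i \<le> length as. malcev_series G as i \<lhd> G) \<and>
     (\<forall>i < length as. malcev_series G as (Suc i) \<subset> malcev_series G as i) \<and>
     (\<forall>i < length as. \<forall>h \<in> malcev_series G as i. \<forall>g \<in> carrier G.
        h \<otimes>\<^bsub>G\<^esub> g \<otimes>\<^bsub>G\<^esub> inv\<^bsub>G\<^esub> h \<otimes>\<^bsub>G\<^esub> inv\<^bsub>G\<^esub> g \<in> malcev_series G as (Suc i))"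

text \<open>The dual of \<open>\<rat>G\<close> is identified with the functions from \<open>carrier G\<close> to \<open>\<rat>\<close>. Since
  HOL functions are total, such a function is represented by its extension by 0 outside the
  carrier, which makes the space of these functions a subspace of \<open>'a \<Rightarrow> rat\<close>.\<close>

definition fun_scale :: "rat \<Rightarrow> ('a \<Rightarrow> rat) \<Rightarrow> ('a \<Rightarrow> rat)" where
  "fun_scale c f = (\<lambda>x. c * f x)"

global_interpretation fun_rat: vector_space "fun_scale :: rat \<Rightarrow> ('a \<Rightarrow> rat) \<Rightarrow> ('a \<Rightarrow> rat)"
  by unfold_locales (simp_all add: fun_scale_def fun_eq_iff algebra_simps)

definition dual_space :: "('a, 'b) monoid_scheme \<Rightarrow> ('a \<Rightarrow> rat) set" where
  "dual_space G = {f. \<forall>h. h \<notin> carrier G \<longrightarrow> f h = 0}"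

definition dual_act :: "('a, 'b) monoid_scheme \<Rightarrow> ('a \<Rightarrow> rat) \<Rightarrow> 'a \<Rightarrow> ('a \<Rightarrow> rat)" where
  "dual_act G f g = (\<lambda>h. if h \<in> carrier G then f (h \<otimes>\<^bsub>G\<^esub> inv\<^bsub>G\<^esub> g) else 0)"

definition dual_submodule :: "('a, 'b) monoid_scheme \<Rightarrow> ('a \<Rightarrow> rat) set \<Rightarrow> bool" where
  "dual_submodule G W \<longleftrightarrow>
     W \<subseteq> dual_space G \<and> fun_rat.subspace W \<and> (\<forall>f \<in> W. \<forall>g \<in> carrier G. dual_act G f g \<in> W)"

definition submodule_generated :: "('a, 'b) monoid_scheme \<Rightarrow> ('a \<Rightarrow> rat) set \<Rightarrow> ('a \<Rightarrow> rat) set" where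
  "submodule_generated G S = \<Inter>{W. dual_submodule G W \<and> S \<subseteq> W}"

definition coord :: "('a, 'b) monoid_scheme \<Rightarrow> 'a list \<Rightarrow> nat \<Rightarrow> 'a \<Rightarrow> rat" where
  "coord G as i g =
     (if g \<in> carrier G
      then of_int ((THE xs. length xs = length as \<and> g = malcev_prod G as xs) ! i) else 0)"

definition nickel_module :: "('a, 'b) monoid_scheme \<Rightarrow> 'a list \<Rightarrow> ('a \<Rightarrow> rat) set" where
  "nickel_module G as = submodule_generated G (coord G as ` {..<length as})"

text \<open>\<^const>\<open>fun_rat.dim\<close> is 0 on subspaces without a finite basis, so bounds on
  \<open>nickel_dim\<close> are meaningful only together with \<open>nickel_finite_dim\<close>.\<close>

definition nickel_finite_dim :: "('a, 'b) monoid_scheme \<Rightarrow> 'a list \<Rightarrow> bool" where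
  "nickel_finite_dim G as \<longleftrightarrow> (\<exists>B. finite B \<and> fun_rat.span B = nickel_module G as)"

definition nickel_dim :: "('a, 'b) monoid_scheme \<Rightarrow> 'a list \<Rightarrow> nat" where
  "nickel_dim G as = fun_rat.dim (nickel_module G as)"

end

theory Submission
  imports Defs
begin

text \<open>
  Consider the products of matrix entries \<open>h(p\<^sub>1,q\<^sub>1) \<cdots> h(p\<^sub>k,q\<^sub>k)\<close> with
  \<open>p\<^sub>1 < q\<^sub>1 \<le> p\<^sub>2 < q\<^sub>2 \<le> \<dots>\<close>. Since \<open>(h u)(p,q)\<close> is a linear combination of the \<open>h(p,k)\<close> with
  \<open>p \<le> k \<le> q\<close>, their span is invariant under right translation. The entry \<open>h(i,j)\<close> is the
  coordinate of \<open>h\<close> belonging to \<open>s(i,j)\<close> plus a sum of products of coordinates along paths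
  \<open>i = i\<^sub>0 < i\<^sub>1 < \<dots> < i\<^sub>r = j\<close> with \<open>r \<ge> 2\<close>; inverting this by induction on \<open>j - i\<close> shows that
  all coordinates lie in the span. A recursion on the largest index shows that there are
  at most \<open>3\<^sup>m\<^sup>-\<^sup>1\<close> such products.
\<close>

section \<open>Chain monomials and their number\<close>

text \<open>The index bounds the last column from above, so \<open>extend\<close> may start the next
  entry at any \<open>a\<close> not below that column. The empty product is an indicator so that
  every monomial vanishes off the carrier.\<close>

inductive chain_monomial :: "nat \<Rightarrow> nat \<Rightarrow> (int mat \<Rightarrow> rat) \<Rightarrow> bool" for m where
  one: "chain_monomial m 0 (\<lambda>h. if h \<in> carrier (UT m) then 1 else 0)"
| weaken: "chain_monomial m n f \<Longrightarrow> chain_monomial m (Suc n) f"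
| extend: "chain_monomial m a f \<Longrightarrow> a \<le> n \<Longrightarrow>
    chain_monomial m (Suc n) (\<lambda>h. f h * of_int (h $$ (a, Suc n)))"

definition chain_space :: "nat \<Rightarrow> nat \<Rightarrow> (int mat \<Rightarrow> rat) set" where
  "chain_space m b = fun_rat.span (Collect (chain_monomial m b))"

lemma chain_monomials_0:
  "Collect (chain_monomial m 0) = {\<lambda>h. if h \<in> carrier (UT m) then 1 else 0}"
  by (auto elim: chain_monomial.cases intro: chain_monomial.intros)

lemma chain_monomials_Suc:
  "Collect (chain_monomial m (Suc n)) = Collect (chain_monomial m n) \<union>
    (\<Union>a\<le>n. (\<lambda>f h. f h * of_int (h $$ (a, Suc n))) ` Collect (chain_monomial m a))"
  by (subst chain_monomial.simps[abs_def]) auto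

text \<open>Splitting by the last entry gives
  \<open>c (k+1) \<le> c k + (\<Sum>a\<le>k. c a)\<close>, and
  \<open>3^k + (3^(k+1) - 1)/2 \<le> 3^(k+1)\<close>.\<close>

lemma card_chain_monomials:
  "finite (Collect (chain_monomial m n)) \<and> card (Collect (chain_monomial m n)) \<le> 3 ^ n"
proof (induction n rule: less_induct)
  case (less n)
  show ?case
  proof (cases n)
    case 0
    then show ?thesis by (simp add: chain_monomials_0)
  next
    case (Suc k)
    let ?C = "\<lambda>a. Collect (chain_monomial m a)"
    let ?I = "\<lambda>a. (\<lambda>f h. f h * of_int (h $$ (a, Suc k))) ` ?C a"
    have IH: "finite (?C a)" "card (?C a) \<le> 3 ^ a" if "a \<le> k" for a
      using less[of a] that Suc by auto
    have "card (?C n) \<le> card (?C k) + card (\<Union>a\<le>k. ?I a)"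
      unfolding Suc chain_monomials_Suc by (rule card_Un_le)
    also have "card (\<Union>a\<le>k. ?I a) \<le> (\<Sum>a\<le>k. card (?I a))"
      by (rule card_UN_le) simp
    also have "\<dots> \<le> (\<Sum>a\<le>k. 3 ^ a)"
      by (rule sum_mono) (meson IH atMost_iff card_image_le le_trans)
    finally have "card (?C n) \<le> 3 ^ k + (\<Sum>a\<le>k. 3 ^ a)"
      using IH[of k] by linarith
    moreover have "2 * (\<Sum>a\<le>k. 3 ^ a) + 1 = (3 ^ Suc k :: nat)"
      by (induction k) auto
    ultimately have "card (?C n) \<le> 3 ^ n"
      using Suc by simp
    moreover have "finite (?C n)"
      unfolding Suc chain_monomials_Suc using IH by auto
    ultimately show ?thesis by simp
  qed
qed

section \<open>The linear span of the chain monomials\<close>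

lemma subspace_chain_space: "fun_rat.subspace (chain_space m b)"
  by (simp add: chain_space_def)

lemma chain_space_add:
  "f \<in> chain_space m b \<Longrightarrow> g \<in> chain_space m b \<Longrightarrow> (\<lambda>h. f h + g h) \<in> chain_space m b"
  using fun_rat.subspace_add[OF subspace_chain_space, of f m b g] by (simp add: plus_fun_def)

lemma chain_space_scale:
  "f \<in> chain_space m b \<Longrightarrow> (\<lambda>h. c * f h) \<in> chain_space m b"
  using fun_rat.subspace_scale[OF subspace_chain_space, of f m b c] by (simp add: fun_scale_def)

lemma chain_space_diff:
  "f \<in> chain_space m b \<Longrightarrow> g \<in> chain_space m b \<Longrightarrow> (\<lambda>h. f h - g h) \<in> chain_space m b"
  using chain_space_add[OF _ chain_space_scale[of g m b "-1"]] by simp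

lemma chain_space_zero: "(\<lambda>h. 0) \<in> chain_space m b"
  using fun_rat.subspace_0[OF subspace_chain_space, of m b] by (simp add: zero_fun_def)

lemma chain_space_sum:
  assumes "\<And>k. k \<in> A \<Longrightarrow> F k \<in> chain_space m b"
  shows "(\<lambda>h. \<Sum>k\<in>A. F k h) \<in> chain_space m b"
  using assms
  by (induction A rule: infinite_finite_induct) (auto intro: chain_space_zero chain_space_add)

lemma chain_space_induct [consumes 1, case_names monomial zero add scale]:
  assumes "f \<in> chain_space m b"
    and "\<And>f. chain_monomial m b f \<Longrightarrow> P f"
    and "P (\<lambda>h. 0)"
    and "\<And>f g. P f \<Longrightarrow> P g \<Longrightarrow> P (\<lambda>h. f h + g h)"
    and "\<And>c f. P f \<Longrightarrow> P (\<lambda>h. c * f h)"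
  shows "P f"
proof -
  have "fun_rat.subspace {f. P f}"
    using assms(3-5)
    by (auto simp: fun_rat.subspace_def zero_fun_def plus_fun_def fun_scale_def)
  with assms(1,2) show ?thesis
    unfolding chain_space_def by (metis (mono_tags, lifting) fun_rat.span_induct mem_Collect_eq)
qed

lemma chain_space_dual: "chain_space m b \<subseteq> dual_space (UT m)"
proof
  fix f assume "f \<in> chain_space m b"
  then show "f \<in> dual_space (UT m)"
  proof (induction rule: chain_space_induct)
    case (monomial f)
    then show ?case by induction (auto simp: dual_space_def)
  qed (auto simp: dual_space_def)
qed

lemma chain_space_mono:
  assumes "a \<le> b"
  shows "chain_space m a \<subseteq> chain_space m b"
proof -
  have "Collect (chain_monomial m a) \<subseteq> Collect (chain_monomial m b)"
    using assms by (induction rule: dec_induct) (auto intro: chain_monomial.weaken)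
  then show ?thesis
    unfolding chain_space_def by (rule fun_rat.span_mono)
qed

lemma UT_entries:
  assumes "h \<in> carrier (UT m)"
  shows "h \<in> carrier_mat m m" "i < m \<Longrightarrow> h $$ (i, i) = 1"
    "j < i \<Longrightarrow> i < m \<Longrightarrow> h $$ (i, j) = 0"
  using assms by (auto simp: UT_def)

text \<open>For \<open>a < b\<close> this is \<open>extend\<close>, made linear in \<open>f\<close>.
  Allowing \<open>a = b\<close>, where the entry is 1 on the carrier, covers the diagonal terms of
  matrix products.\<close>

lemma chain_space_mult_entry:
  assumes "f \<in> chain_space m a" "a \<le> b" "b < m"
  shows "(\<lambda>h. f h * of_int (h $$ (a, b))) \<in> chain_space m b"
proof (cases "a = b")
  case True
  have "(\<lambda>h. f h * of_int (h $$ (a, b))) = f"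
  proof
    fix h
    show "f h * of_int (h $$ (a, b)) = f h"
      using chain_space_dual[of m a] assms UT_entries(2)[of h m a] True
      by (cases "h \<in> carrier (UT m)") (auto simp: dual_space_def)
  qed
  then show ?thesis using assms True by simp
next
  case False
  then obtain n where n: "b = Suc n" "a \<le> n"
    using assms by (cases b) auto
  show ?thesis using assms(1)
  proof (induction rule: chain_space_induct)
    case (monomial f)
    then have "chain_monomial m b (\<lambda>h. f h * of_int (h $$ (a, b)))"
      using n by (auto intro: chain_monomial.extend)
    then show ?case by (simp add: chain_space_def fun_rat.span_base)
  next
    case (add f g)
    then show ?case using chain_space_add[OF add] by (simp add: algebra_simps)
  next
    case (scale c f)
    then show ?case using chain_space_scale[OF scale, of c] by (simp add: algebra_simps)
  qed (simp add: chain_space_zero)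
qed

section \<open>Invariance under right translation\<close>

lemma UT_mult: "g \<otimes>\<^bsub>UT m\<^esub> h = g * h"
  by (simp add: UT_def)

lemma UT_mult_closed:
  assumes "group (UT m)" "g \<in> carrier (UT m)" "h \<in> carrier (UT m)"
  shows "g * h \<in> carrier (UT m)"
proof -
  interpret group "UT m" by fact
  show ?thesis using m_closed[OF assms(2,3)] by (simp add: UT_mult)
qed

text \<open>Translating the last entry \<open>h (a, Suc n)\<close> by \<open>u\<close> only produces
  entries \<open>h (a, k)\<close> with \<open>a \<le> k \<le> Suc n\<close>; each can follow the
  translated prefix, which lies in \<open>chain_space m a\<close> by induction.\<close>

lemma chain_space_translate:
  assumes "group (UT m)" "u \<in> carrier (UT m)" "b < m" "f \<in> chain_space m b"
  shows "(\<lambda>h. if h \<in> carrier (UT m) then f (h * u) else 0) \<in> chain_space m b"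
  using assms(4)
proof (induction rule: chain_space_induct)
  case (monomial f)
  then show ?case using \<open>b < m\<close>
  proof induction
    case one
    have "(\<lambda>h. if h \<in> carrier (UT m) then if h * u \<in> carrier (UT m) then 1 else 0 else 0)
        = (\<lambda>h. if h \<in> carrier (UT m) then 1 else (0::rat))"
      using UT_mult_closed[OF assms(1) _ assms(2)] by (auto simp: fun_eq_iff)
    then show ?case
      using fun_rat.span_base[of _ "Collect (chain_monomial m 0)"]
      by (simp add: chain_space_def chain_monomial.one)
  next
    case (weaken n f)
    then show ?case using chain_space_mono[of n "Suc n" m] by auto
  next
    case (extend a f n)
    let ?f = "\<lambda>h. if h \<in> carrier (UT m) then f (h * u) else 0"
    have f: "?f \<in> chain_space m a" using extend by simp
    have "(\<lambda>h. \<Sum>k=a..Suc n. of_int (u $$ (k, Suc n)) * (?f h * of_int (h $$ (a, k))))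
        \<in> chain_space m (Suc n)"
    proof (intro chain_space_sum chain_space_scale)
      fix k assume "k \<in> {a..Suc n}"
      then show "(\<lambda>h. ?f h * of_int (h $$ (a, k))) \<in> chain_space m (Suc n)"
        using chain_space_mult_entry[OF f, of k] chain_space_mono[of k "Suc n" m] extend.prems
        by auto
    qed
    also have "(\<lambda>h. \<Sum>k=a..Suc n. of_int (u $$ (k, Suc n)) * (?f h * of_int (h $$ (a, k))))
      = (\<lambda>h. if h \<in> carrier (UT m) then f (h * u) * of_int ((h * u) $$ (a, Suc n)) else 0)"
    proof
      fix h
      have "(h * u) $$ (a, Suc n) = (\<Sum>k=a..Suc n. h $$ (a, k) * u $$ (k, Suc n))"
        if h: "h \<in> carrier (UT m)"
      proof -
        have "(h * u) $$ (a, Suc n) = (\<Sum>k<m. h $$ (a, k) * u $$ (k, Suc n))"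
          using UT_entries(1)[OF h] UT_entries(1)[OF assms(2)] extend
          by (simp add: scalar_prod_def lessThan_atLeast0)
        \<comment> \<open>Terms with \<open>k < a\<close> vanish by triangularity of
          \<open>h\<close>, those with \<open>k > Suc n\<close> by that of \<open>u\<close>.\<close>
        also have "\<dots> = (\<Sum>k=a..Suc n. h $$ (a, k) * u $$ (k, Suc n))"
          using extend UT_entries(3)[OF h] UT_entries(3)[OF assms(2)]
          by (intro sum.mono_neutral_right) auto
        finally show ?thesis .
      qed
      then show "(\<Sum>k=a..Suc n. of_int (u $$ (k, Suc n)) * (?f h * of_int (h $$ (a, k))))
          = (if h \<in> carrier (UT m) then f (h * u) * of_int ((h * u) $$ (a, Suc n)) else 0)"
        by (simp add: sum_distrib_left mult_ac del: sum.cl_ivl_Suc)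
    qed
    finally show ?case .
  qed
next
  case zero
  show ?case using chain_space_zero[of m b] by simp
next
  case (add f g)
  show ?case by (rule back_subst[of "\<lambda>x. x \<in> chain_space m b", OF chain_space_add[OF add]]) auto
next
  case (scale c f)
  show ?case
    by (rule back_subst[of "\<lambda>x. x \<in> chain_space m b", OF chain_space_scale[OF scale, of c]]) auto
qed

lemma dual_submodule_chain_space:
  assumes "group (UT m)" "b < m"
  shows "dual_submodule (UT m) (chain_space m b)"
proof -
  interpret group "UT m" by fact
  have "dual_act (UT m) f g \<in> chain_space m b" if "f \<in> chain_space m b" "g \<in> carrier (UT m)" for f g
    using chain_space_translate[OF assms(1) inv_closed[OF that(2)] assms(2) that(1)]
    unfolding dual_act_def UT_mult .
  then show ?thesis
    by (simp add: dual_submodule_def chain_space_dual subspace_chain_space)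
qed

section \<open>Transvections and their integer powers\<close>

lemma transvection_carrier: "i < j \<Longrightarrow> transvection m i j \<in> carrier (UT m)"
  by (auto simp: UT_def transvection_def elem_mat_def)

lemma transvection_inject:
  assumes "i < j" "j < m" "k < l" "l < m" "transvection m i j = transvection m k l"
  shows "i = k \<and> j = l"
proof -
  have "transvection m i j $$ (i, j) = transvection m k l $$ (i, j)" using assms by simp
  then show ?thesis using assms by (auto simp: transvection_def elem_mat_def split: if_splits)
qed

text \<open>Left multiplication by the power is the row operation adding \<open>x\<close> times row
  \<open>l\<close> to row \<open>k\<close>.\<close>

lemma transvection_pow_mult:
  fixes x :: int
  assumes "group (UT m)" "k < l" "l < m" "h \<in> carrier (UT m)" "i < m" "j < m"
  shows "(transvection m k l [^]\<^bsub>UT m\<^esub> x \<otimes>\<^bsub>UT m\<^esub> h) $$ (i, j)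
    = h $$ (i, j) + (if i = k then x * h $$ (l, j) else 0)"
proof -
  interpret group "UT m" by fact
  \<comment> \<open>\<open>T y\<close> is the closed form of the \<open>y\<close>-th power:
    \<open>T\<close> turns addition into multiplication, because \<open>elem_mat m k l\<close>
    squares to zero.\<close>
  define T where "T y = 1\<^sub>m m + y \<cdot>\<^sub>m elem_mat m k l" for y
  have T_carrier: "T y \<in> carrier (UT m)" for y
    using assms by (auto simp: UT_def T_def elem_mat_def)
  have T_mult: "(T y \<otimes>\<^bsub>UT m\<^esub> A) $$ (p, q) = A $$ (p, q) + (if p = k then y * A $$ (l, q) else 0)"
    if "A \<in> carrier (UT m)" "p < m" "q < m" for A y p q
  proof -
    have "(T y \<otimes>\<^bsub>UT m\<^esub> A) $$ (p, q) = (\<Sum>s<m. T y $$ (p, s) * A $$ (s, q))"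
      using that UT_entries(1)[OF T_carrier[of y]] UT_entries(1)[OF that(1)]
      by (simp add: UT_mult scalar_prod_def lessThan_atLeast0)
    also have "\<dots> = (\<Sum>s<m. (if s = p then A $$ (s, q) else 0)
        + (if s = l then if p = k then y * A $$ (l, q) else 0 else 0))"
      using that by (intro sum.cong) (auto simp: T_def elem_mat_def algebra_simps)
    also have "\<dots> = A $$ (p, q) + (if p = k then y * A $$ (l, q) else 0)"
      using that assms by (simp add: sum.distrib)
    finally show ?thesis .
  qed
  have T_add: "T y \<otimes>\<^bsub>UT m\<^esub> T z = T (y + z)" for y z
  proof (rule eq_matI)
    show "(T y \<otimes>\<^bsub>UT m\<^esub> T z) $$ (p, q) = T (y + z) $$ (p, q)"
      if "p < dim_row (T (y + z))" "q < dim_col (T (y + z))" for p q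
    proof -
      have pq: "p < m" "q < m" using that by (auto simp: T_def elem_mat_def)
      show ?thesis
        unfolding T_mult[OF T_carrier pq] using pq assms(2,3)
        by (auto simp: T_def elem_mat_def)
    qed
  qed (use UT_entries(1)[OF m_closed[OF T_carrier[of y] T_carrier[of z]]]
      UT_entries(1)[OF T_carrier[of "y + z"]] in auto)
  have T_0: "T 0 = \<one>\<^bsub>UT m\<^esub>"
    by (auto simp: T_def UT_def elem_mat_def)
  have T_1: "transvection m k l = T 1"
    by (auto simp: T_def transvection_def elem_mat_def)
  have T_nat: "T 1 [^]\<^bsub>UT m\<^esub> n = T (int n)" for n :: nat
    by (induction n) (simp_all add: T_0 T_add add.commute)
  have "T 1 [^]\<^bsub>UT m\<^esub> x = T x"
  proof (cases x rule: int_cases2)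
    case (nonneg n)
    then show ?thesis by (simp add: int_pow_int T_nat)
  next
    case (nonpos n)
    have "inv\<^bsub>UT m\<^esub> T (int n) = T (- int n)"
      by (rule inv_equality) (simp_all add: T_add T_0 T_carrier)
    then show ?thesis
      using nonpos T_carrier by (simp add: int_pow_neg int_pow_int T_nat)
  qed
  then show ?thesis
    using T_mult[OF assms(4-6)] T_1 by simp
qed

section \<open>Mal'cev coordinates as combinations of chain monomials\<close>

lemma malcev_prod_closed:
  assumes "group G" "set as \<subseteq> carrier G"
  shows "malcev_prod G as xs \<in> carrier G"
proof -
  interpret group G by fact
  show ?thesis using assms(2)
  proof (induction as arbitrary: xs)
    case (Cons a as)
    then show ?case
      by (cases xs) (auto simp: malcev_prod_def)
  qed (simp add: malcev_prod_def)
qed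

lemma malcev_basis_group: "malcev_basis G as \<Longrightarrow> group G"
  by (auto simp: malcev_basis_def normal_def)

text \<open>The factor \<open>f\<close> is what lets the induction on \<open>j - i\<close> compose along a path.\<close>

lemma coord_chain_space:
  assumes dist: "distinct as"
    and set_as: "set as = {transvection m i j | i j. i < j \<and> j < m}"
    and basis: "malcev_basis (UT m) as"
    and "i < j" "j < m" "r < length as" "as ! r = transvection m i j" "f \<in> chain_space m i"
  shows "(\<lambda>h. f h * coord (UT m) as r h) \<in> chain_space m j"
proof -
  have grp: "group (UT m)" using malcev_basis_group[OF basis] .
  define X where "X h = (THE xs. length xs = length as \<and> h = malcev_prod (UT m) as xs)" for h
  \<comment> \<open>\<open>P r h\<close> is the tail of the normal form of \<open>h\<close> from
    factor \<open>r\<close> on; it runs from \<open>h\<close> at \<open>r = 0\<close> to the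
    identity at \<open>r = length as\<close>.\<close>
  define P where "P r h = malcev_prod (UT m) (drop r as) (drop r (X h))" for r h
  define p where "p r i j h = (of_int (P r h $$ (i, j)) :: rat)" for r i j h
  let ?c = "coord (UT m) as"
  let ?n = "length as"
  have X: "length (X h) = ?n \<and> h = malcev_prod (UT m) as (X h)" if "h \<in> carrier (UT m)" for h
    unfolding X_def by (rule theI') (use basis that in \<open>auto simp: malcev_basis_def\<close>)
  have P_carrier: "P r h \<in> carrier (UT m)" for r h
    unfolding P_def
    by (rule malcev_prod_closed[OF grp])
       (use basis set_drop_subset[of r as] in \<open>auto simp: malcev_basis_def\<close>)
  have p_diag: "p r i i h = 1" if "i < m" for r i h
    using UT_entries(2)[OF P_carrier that] by (simp add: p_def)
  have p_lower: "p r i j h = 0" if "j < i" "i < m" for r i j h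
    using UT_entries(3)[OF P_carrier that] by (simp add: p_def)
  have p_0: "p 0 i j h = of_int (h $$ (i, j))" if "h \<in> carrier (UT m)" for i j h
    using X[OF that] by (simp add: p_def P_def)
  have p_n: "p ?n i j h = 0" if "i < j" "j < m" for i j h
    using that by (simp add: p_def P_def malcev_prod_def UT_def)
  have p_rec: "p r i j h = p (Suc r) i j h + (if i = k then ?c r h * p (Suc r) l j h else 0)"
    if "h \<in> carrier (UT m)" "r < ?n" "as ! r = transvection m k l" "k < l" "l < m" "i < m" "j < m"
    for r i j k l h
  proof -
    have "P r h = transvection m k l [^]\<^bsub>UT m\<^esub> (X h ! r) \<otimes>\<^bsub>UT m\<^esub> P (Suc r) h"
      using that X[OF that(1)]
      by (simp add: P_def malcev_prod_def Cons_nth_drop_Suc[symmetric])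
    moreover have "?c r h = of_int (X h ! r)"
      using that by (simp add: coord_def X_def)
    ultimately show ?thesis
      using transvection_pow_mult[OF grp that(4,5) P_carrier that(6,7)] by (simp add: p_def)
  qed
  have outside: "f h = 0" if "f \<in> chain_space m i" "h \<notin> carrier (UT m)" for f i h
    using chain_space_dual that by (auto simp: dual_space_def)
  \<comment> \<open>Coordinates and tail entries go through one induction, since peeling off a
    factor yields a coordinate times a tail entry.\<close>
  have "(\<forall>r<?n. as ! r = transvection m i j \<longrightarrow> (\<lambda>h. f h * ?c r h) \<in> chain_space m j) \<and>
      (\<forall>r\<le>?n. (\<lambda>h. f h * p r i j h) \<in> chain_space m j)"
    if "i < j" "j < m" "f \<in> chain_space m i" for i j f
    using that
  proof (induction "j - i" arbitrary: i j f rule: less_induct)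
    case less
    note IH_coord = less.hyps[THEN conjunct1, rule_format]
    note IH_p = less.hyps[THEN conjunct2, rule_format]
    have "transvection m i j \<in> set as" using less.prems set_as by blast
    then obtain r0 where r0: "r0 < ?n" "as ! r0 = transvection m i j"
      by (auto simp: in_set_conv_nth)
    \<comment> \<open>The coordinate of \<open>s(i,j)\<close> is subtracted as long as its factor
      \<open>r0\<close> is still in the tail, so \<open>q\<close> keeps only the contributions of
      paths with at least two steps.\<close>
    define q where "q r h = f h * (p r i j h - (if r \<le> r0 then ?c r0 h else 0))" for r h
    have q: "q r \<in> chain_space m j" if "r \<le> ?n" for r
      using that
    proof (induction rule: inc_induct)
      case base
      have "q ?n = (\<lambda>h. 0)"
        using r0 less.prems p_n by (auto simp: q_def)
      then show ?case by (simp add: chain_space_zero)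
    next
      case (step r)
      have "as ! r \<in> set as" using step by simp
      then obtain k l where kl: "as ! r = transvection m k l" "k < l" "l < m"
        unfolding set_as by auto
      note rec = p_rec[OF _ step.hyps(2) kl, of _ i j]
      show ?case
      proof (cases "i = k \<and> l < j")
        case True
        then have "r \<noteq> r0"
          using transvection_inject[OF less.prems(1,2) kl(2,3)] r0 kl by auto
        \<comment> \<open>The path splits at \<open>l\<close>: the coordinate carries
          \<open>f\<close> from \<open>i\<close> to \<open>l\<close>, then the tail entry carries
          the product from \<open>l\<close> to \<open>j\<close>. Both intervals are shorter than
          \<open>j - i\<close>.\<close>
        have "(\<lambda>h. f h * ?c r h) \<in> chain_space m l"
          using True kl less.prems step.hyps by (intro IH_coord[of l i]) auto
        then have "(\<lambda>h. f h * ?c r h * p (Suc r) l j h) \<in> chain_space m j"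
          using True kl less.prems step.hyps by (intro IH_p[of j l]) auto
        from chain_space_add[OF step.IH this]
        show ?thesis
        proof (rule back_subst[of "\<lambda>x. x \<in> chain_space m j"], intro ext)
          fix h
          show "q (Suc r) h + f h * ?c r h * p (Suc r) l j h = q r h"
            using rec[of h] True less.prems outside[OF less.prems(3), of h] \<open>r \<noteq> r0\<close>
            by (cases "h \<in> carrier (UT m)") (auto simp: q_def algebra_simps)
        qed
      next
        case False
        \<comment> \<open>Three reasons: row \<open>i\<close> is untouched if
          \<open>k \<noteq> i\<close>; \<open>p (Suc r) l j\<close> is below the diagonal if
          \<open>l > j\<close>; for \<open>l = j\<close> the factor is \<open>r0\<close>, and the
          coordinate it adds is cancelled by the correction in \<open>q\<close>.\<close>
        have "q (Suc r) = q r"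
        proof
          fix h
          show "q (Suc r) h = q r h"
          proof (cases "h \<in> carrier (UT m)")
            case h: True
            show ?thesis
            proof (cases "r = r0")
              case True
              then have "k = i \<and> l = j"
                using transvection_inject[OF less.prems(1,2) kl(2,3)] r0 kl by auto
              then show ?thesis
                using rec[OF h] less.prems True p_diag by (simp add: q_def)
            next
              case r: False
              then have "i = k \<Longrightarrow> j < l"
                using dist r0 kl step.hyps False by (metis linorder_neqE_nat nth_eq_iff_index_eq)
              then have "p r i j h = p (Suc r) i j h"
                using rec[OF h] less.prems p_lower kl by auto
              then show ?thesis using r by (simp add: q_def Suc_le_eq order_le_less)
            qed
          qed (use outside[OF less.prems(3)] in \<open>simp add: q_def\<close>)
        qed
        then show ?thesis using step.IH by simp
      qed
    qed
    \<comment> \<open>At \<open>r = 0\<close> the tail is all of \<open>h\<close>, so the coordinate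
      is the matrix entry minus the longer paths.\<close>
    have "(\<lambda>h. f h * of_int (h $$ (i, j)) - q 0 h) \<in> chain_space m j"
      using less.prems q by (intro chain_space_diff chain_space_mult_entry) auto
    also have "(\<lambda>h. f h * of_int (h $$ (i, j)) - q 0 h) = (\<lambda>h. f h * ?c r0 h)"
    proof
      fix h
      show "f h * of_int (h $$ (i, j)) - q 0 h = f h * ?c r0 h"
        using p_0[of h i j] outside[OF less.prems(3), of h]
        by (cases "h \<in> carrier (UT m)") (auto simp: q_def algebra_simps)
    qed
    finally have c: "(\<lambda>h. f h * ?c r0 h) \<in> chain_space m j" .
    have "(\<lambda>h. f h * p r i j h) \<in> chain_space m j" if "r \<le> ?n" for r
    proof -
      have "(\<lambda>h. q r h + (if r \<le> r0 then 1 else 0) * (f h * ?c r0 h)) \<in> chain_space m j"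
        by (intro chain_space_add chain_space_scale q c that)
      then show ?thesis
        by (rule back_subst[of "\<lambda>x. x \<in> chain_space m j"]) (auto simp: q_def algebra_simps)
    qed
    moreover have "r = r0" if "r < ?n" "as ! r = transvection m i j" for r
      using that r0 dist nth_eq_iff_index_eq by metis
    ultimately show ?case using c by blast
  qed
  with assms show ?thesis by blast
qed

section \<open>The dimension of the Nickel module\<close>

theorem theorem3p3:
  fixes m :: nat and as :: "int mat list"
  assumes "m \<ge> 2"
    and "distinct as"
    and "set as = {transvection m i j | i j. i < j \<and> j < m}"
    and "malcev_basis (UT m) as"
  shows "nickel_finite_dim (UT m) as \<and> nickel_dim (UT m) as \<le> 3 ^ m"
proof -
  \<comment> \<open>With 0-based indices, \<open>m - 1\<close> is the largest column.\<close>
  let ?V = "chain_space m (m - 1)"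
  let ?C = "Collect (chain_monomial m (m - 1))"
  let ?N = "nickel_module (UT m) as"
  have "coord (UT m) as r \<in> ?V" if r: "r < length as" for r
  proof -
    have "as ! r \<in> set as" using r by simp
    then obtain i j where ij: "as ! r = transvection m i j" "i < j" "j < m"
      unfolding assms(3) by auto
    \<comment> \<open>The empty product serves as the factor \<open>f\<close>; multiplying by it
      changes nothing, as coordinates vanish off the carrier.\<close>
    let ?e = "\<lambda>h. if h \<in> carrier (UT m) then 1 else (0::rat)"
    have "?e \<in> chain_space m 0"
      unfolding chain_space_def by (intro fun_rat.span_base CollectI chain_monomial.one)
    then have "?e \<in> chain_space m i"
      using chain_space_mono[of 0 i m] by auto
    from coord_chain_space[OF assms(2-4) ij(2,3) r ij(1) this]
    have "(\<lambda>h. ?e h * coord (UT m) as r h) \<in> ?V"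
    proof (rule subsetD[OF chain_space_mono, rotated])
      show "j \<le> m - 1" using ij by simp
    qed
    then show ?thesis
      by (rule back_subst[of "\<lambda>x. x \<in> ?V"]) (auto simp: coord_def)
  qed
  moreover have "dual_submodule (UT m) ?V"
    using dual_submodule_chain_space[OF malcev_basis_group[OF assms(4)]] assms(1) by simp
  ultimately have N_V: "?N \<subseteq> ?V"
    unfolding nickel_module_def submodule_generated_def by blast
  have N_subspace: "fun_rat.subspace ?N"
    unfolding nickel_module_def submodule_generated_def
    by (rule fun_rat.subspace_Inter) (auto simp: dual_submodule_def)
  obtain B where B: "B \<subseteq> ?N" "fun_rat.independent B" "?N \<subseteq> fun_rat.span B" "card B = fun_rat.dim ?N"
    using fun_rat.basis_exists[of ?N] by blast
  \<comment> \<open>Finiteness of the basis \<open>B\<close> rules out that the dimension is just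
    the default value 0.\<close>
  have "finite B \<and> card B \<le> card ?C"
    using B N_V card_chain_monomials[of m "m - 1"]
    by (intro fun_rat.independent_span_bound) (auto simp: chain_space_def)
  moreover have "card ?C \<le> 3 ^ m"
    using card_chain_monomials[of m "m - 1"] power_increasing[of "m - 1" m "3::nat"] by linarith
  moreover have "fun_rat.span B = ?N"
    using B fun_rat.span_minimal[OF B(1) N_subspace] by blast
  ultimately show ?thesis
    unfolding nickel_finite_dim_def nickel_dim_def using B(4) by (metis le_trans)
qed

end
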